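(* Let $\omega_0\in[0,\pi]$ and let $\boldsymbol\phi_{\omega_0}=(\phi_{1,\omega_0},\phi_{2,\omega_0})^T$ be the pair of Hermite exponential spline generators defined in the context. Then the system of integer translates $\{\boldsymbol\phi_{\omega_0}(\cdot-n):\ n\in\mathbb{Z}\}$ forms a Riesz basis; that is, there exist constants $0<\alpha\le\beta<+\infty$ such that for every $\mathbf{a}\in\ell_2^{2\times 1}(\mathbb{Z})$, $$\alpha\,\|\mathbf{a}\|_{\ell_2}\ \le\ \Big\|\sum_{n\in\mathbb{Z}}\mathbf{a}^T[n]\,\boldsymbol\phi_{\omega_0}(\cdot-n)\Big\|_{L_2(\mathbb{R})}\ \le\ \beta\,\|\mathbf{a}\|_{\ell_2}.$$
   Context: $\ell_2^{2\times1}(\mathbb{Z})$ is the space of square-summable sequences $\mathbf{a}=(\mathbf{a}[n])_{n\in\mathbb{Z}}$ of $2\times1$ vectors, with its usual norm. For $\omega_0\in(0,\pi]$ put $$s(\omega_0)=2\sin(\omega_0/2)-\omega_0\cos(\omega_0/2),\qquad t(\omega_0)=2\sin(\omega_0/2)+\omega_0\cos(\omega_0/2),$$ $$u(\omega_0)=\omega_0\sin(\omega_0)-2(1-\cos(\omega_0)),\qquad v(\omega_0)=2\sin(\omega_0)+\omega_0(1-\cos(\omega_0)),$$ and let $\chi_{[0,1]}$ be the indicator function of $[0,1]$. Define $$g_{1,\omega_0}(x)=\Big(1-\tfrac{\sin(\omega_0/2)}{s(\omega_0)}+\tfrac{\omega_0\cos(\omega_0/2)}{s(\omega_0)}x+\tfrac{\sin(\omega_0/2-\omega_0x)}{s(\omega_0)}\Big)\chi_{[0,1]}(x),$$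 $$g_{2,\omega_0}(x)=\Big(\tfrac{\sin(\omega_0)-\omega_0\cos(\omega_0)}{\omega_0u(\omega_0)}+\tfrac{\sin(\omega_0/2)}{s(\omega_0)}x-\tfrac{\omega_0^2\cos(\omega_0/2)\cos(\omega_0(1-x))+\sin(\omega_0/2)\big(\sin(\omega_0x)u(\omega_0)-\cos(\omega_0x)v(\omega_0)\big)}{2\omega_0\sin(\omega_0/2)s(\omega_0)t(\omega_0)}\Big)\chi_{[0,1]}(x).$$ The generators are $\phi_{1,\omega_0}(x)=g_{1,\omega_0}(x)$ for $x\ge0$, $\phi_{1,\omega_0}(x)=g_{1,\omega_0}(-x)$ for $x<0$; and $\phi_{2,\omega_0}(x)=g_{2,\omega_0}(x)$ for $x\ge0$, $\phi_{2,\omega_0}(x)=-g_{2,\omega_0}(-x)$ for $x<0$. On $[0,1]$, $\phi_{1,\omega_0}$ and $\phi_{2,\omega_0}$ are the elements of $\mathrm{span}\{1,x,e^{i\omega_0x},e^{-i\omega_0x}\}$ with $\phi_1(0)=1,\phi_1'(0)=\phi_1(1)=\phi_1'(1)=0$ and $\phi_2'(0)=1,\phi_2(0)=\phi_2(1)=\phi_2'(1)=0$, respectively. For $\omega_0=0$ the functions are understood as the limits as $\omega_0\to0$: $g_{1,0}(x)=(2x+1)(x-1)^2\chi_{[0,1]}(x)$ and $g_{2,0}(x)=x(x-1)^2\chi_{[0,1]}(x)$, with the same symmetric and antisymmetric extensions. *)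

theory Defs
  imports "HOL-Analysis.Analysis"
begin

definition s_coeff :: "real \<Rightarrow> real" where
  "s_coeff \<omega> = 2 * sin (\<omega>/2) - \<omega> * cos (\<omega>/2)"

definition t_coeff :: "real \<Rightarrow> real" where
  "t_coeff \<omega> = 2 * sin (\<omega>/2) + \<omega> * cos (\<omega>/2)"

definition u_coeff :: "real \<Rightarrow> real" where
  "u_coeff \<omega> = \<omega> * sin \<omega> - 2 * (1 - cos \<omega>)"

definition v_coeff :: "real \<Rightarrow> real" where
  "v_coeff \<omega> = 2 * sin \<omega> + \<omega> * (1 - cos \<omega>)"

(* The value at \<omega> = 0 is the pointwise limit as \<omega> tends to 0; the closed formula
   would divide by zero there. *)
definition g1 :: "real \<Rightarrow> real \<Rightarrow> real" where
  "g1 \<omega> x =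
    (if \<omega> = 0 then (2 * x + 1) * (x - 1)\<^sup>2
     else 1 - sin (\<omega>/2) / s_coeff \<omega>
          + \<omega> * cos (\<omega>/2) / s_coeff \<omega> * x
          + sin (\<omega>/2 - \<omega> * x) / s_coeff \<omega>)
    * indicat_real {0..1} x"

definition g2 :: "real \<Rightarrow> real \<Rightarrow> real" where
  "g2 \<omega> x =
    (if \<omega> = 0 then x * (x - 1)\<^sup>2
     else (sin \<omega> - \<omega> * cos \<omega>) / (\<omega> * u_coeff \<omega>)
          + sin (\<omega>/2) / s_coeff \<omega> * x
          - (\<omega>\<^sup>2 * cos (\<omega>/2) * cos (\<omega> * (1 - x))
             + sin (\<omega>/2) * (sin (\<omega> * x) * u_coeff \<omega> - cos (\<omega> * x) * v_coeff \<omega>))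
            / (2 * \<omega> * sin (\<omega>/2) * s_coeff \<omega> * t_coeff \<omega>))
    * indicat_real {0..1} x"

definition phi1 :: "real \<Rightarrow> real \<Rightarrow> real" where
  "phi1 \<omega> x = (if x \<ge> 0 then g1 \<omega> x else g1 \<omega> (- x))"

definition phi2 :: "real \<Rightarrow> real \<Rightarrow> real" where
  "phi2 \<omega> x = (if x \<ge> 0 then g2 \<omega> x else - g2 \<omega> (- x))"

definition hermite_gen :: "real \<Rightarrow> real \<Rightarrow> real ^ 2" where
  "hermite_gen \<omega> x = vector [phi1 \<omega> x, phi2 \<omega> x]"

(* Square-summable two-sided sequences of complex 2-vectors; the norm of complex ^ 2
   is the Euclidean one. *)
definition l2_seq :: "(int \<Rightarrow> complex ^ 2) set" where
  "l2_seq = {a. (\<lambda>n. (norm (a n))\<^sup>2) summable_on UNIV}"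

definition l2_seq_norm :: "(int \<Rightarrow> complex ^ 2) \<Rightarrow> real" where
  "l2_seq_norm a = sqrt (\<Sum>\<^sub>\<infinity>n. (norm (a n))\<^sup>2)"

definition L2_fun :: "(real \<Rightarrow> complex) set" where
  "L2_fun = {f. f \<in> borel_measurable lborel \<and> integrable lborel (\<lambda>x. (cmod (f x))\<^sup>2)}"

definition L2_fun_norm :: "(real \<Rightarrow> complex) \<Rightarrow> real" where
  "L2_fun_norm f = sqrt (LINT x|lborel. (cmod (f x))\<^sup>2)"

(* Unconditional convergence in L2 of a family of functions. *)
definition has_L2_sum :: "(int \<Rightarrow> real \<Rightarrow> complex) \<Rightarrow> (real \<Rightarrow> complex) \<Rightarrow> bool" where
  "has_L2_sum f F \<longleftrightarrow>
     (\<forall>n. f n \<in> L2_fun) \<and> F \<in> L2_fun \<and>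
     ((\<lambda>N. L2_fun_norm (\<lambda>x. (\<Sum>n\<in>N. f n x) - F x)) \<longlongrightarrow> 0) (finite_subsets_at_top UNIV)"

definition translate_term :: "real \<Rightarrow> (int \<Rightarrow> complex ^ 2) \<Rightarrow> int \<Rightarrow> real \<Rightarrow> complex" where
  "translate_term \<omega> a n x =
     (\<Sum>i\<in>UNIV. a n $ i * complex_of_real (hermite_gen \<omega> (x - of_int n) $ i))"

(* The generators are supported in [-1, 1], so for each x only finitely many terms are nonzero. *)
definition translate_series :: "real \<Rightarrow> (int \<Rightarrow> complex ^ 2) \<Rightarrow> real \<Rightarrow> complex" where
  "translate_series \<omega> a x = (\<Sum>\<^sub>\<infinity>n. translate_term \<omega> a n x)"

end

theory Submission
  imports Defs
begin

text \<open>
  The generators are supported in \<open>[-1, 1]\<close>, so on a cell \<open>[n, n + 1]\<close> the series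
  depends only on the two coefficient vectors \<open>a n\<close> and \<open>a (n + 1)\<close>. There it is the Hermite
  interpolant with values and slopes \<open>a n\<close> at the left end and \<open>a (n + 1)\<close> at the right end
  (\<open>translate_series_local\<close>), translated to the unit interval. The map from the four
  endpoint data to the interpolant is linear and injective, since the data can be read off from the
  interpolant (\<open>hermite_cell_eq_0_imp\<close>). As the data space is finite-dimensional, the energy
  of the interpolant on the unit interval lies between \<open>m\<close> and \<open>M\<close> times
  \<open>|a n|\<^sup>2 + |a (n + 1)|\<^sup>2\<close> with constants \<open>0 < m \<le> M\<close> that are the same for all cells
  (\<open>unit_interval_energy_bounds\<close>).

  Adding up the energies of all cells (\<open>cellwise_energy\<close>) counts every coefficient vector twice,
  which gives the Riesz bounds \<open>\<alpha> = sqrt (2 * m)\<close> and \<open>\<beta> = sqrt (2 * M)\<close>.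

  Convergence of the series in \<open>L\<^sub>2\<close> then follows from the upper bound. The error of a finite
  partial sum is, up to sign, itself such a series, whose coefficients are the tail of \<open>a\<close>.
\<close>

section \<open>Energy of a finite-dimensional family on the unit interval\<close>

text \<open>
  The energy is a continuous function of the parameter \<open>c\<close>, positive off zero because a
  continuous function with vanishing energy is zero. On the compact unit sphere it therefore
  attains a positive minimum and a finite maximum, and quadratic homogeneity carries these bounds
  to all \<open>c\<close>.
\<close>

lemma unit_interval_energy_bounds:
  fixes T :: "'v::euclidean_space \<Rightarrow> real \<Rightarrow> complex"
  assumes cont: "continuous_on (UNIV \<times> {0..1}) (\<lambda>(c, y). T c y)"
    and scale: "\<And>r c y. T (r *\<^sub>R c) y = r *\<^sub>R T c y"
    and inj: "\<And>c. (\<And>y. y \<in> {0..1} \<Longrightarrow> T c y = 0) \<Longrightarrow> c = 0"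
  obtains m M where "0 < m" "m \<le> M"
    "\<And>c. m * (norm c)\<^sup>2 \<le> integral {0..1} (\<lambda>y. (cmod (T c y))\<^sup>2)"
    "\<And>c. integral {0..1} (\<lambda>y. (cmod (T c y))\<^sup>2) \<le> M * (norm c)\<^sup>2"
proof -
  define Q where "Q c = integral {0..1} (\<lambda>y. (cmod (T c y))\<^sup>2)" for c
  let ?S = "sphere (0::'v) 1"
  have contQ: "continuous_on UNIV Q"
  proof -
    have "continuous_on (UNIV \<times> cbox 0 (1::real)) (\<lambda>(c, y). (cmod (T c y))\<^sup>2)"
      using cont by (auto simp: case_prod_beta intro!: continuous_intros)
    from integral_continuous_on_param[OF this] show ?thesis by (simp add: Q_def)
  qed
  have cell: "continuous_on {0..1} (\<lambda>y. (cmod (T c y))\<^sup>2)" for c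
  proof -
    have "continuous_on {0..1} (\<lambda>y. (\<lambda>(c, y). T c y) (c, y))"
      by (rule continuous_on_compose2[OF cont]) (auto intro!: continuous_intros)
    then show ?thesis by (auto intro!: continuous_intros)
  qed
  have pos: "Q c > 0" if "c \<noteq> 0" for c
  proof -
    have "Q c \<ge> 0" unfolding Q_def by (rule integral_nonneg[OF integrable_continuous_real[OF cell]]) auto
    moreover have "Q c \<noteq> 0"
      using integral_eq_0_iff[OF cell[of c]] inj[of c] that by (auto simp: Q_def)
    ultimately show ?thesis by simp
  qed
  have hom: "Q c = Q (sgn c) * (norm c)\<^sup>2" for c
  proof -
    have "Q c = Q (norm c *\<^sub>R sgn c)"
      by (cases "c = 0") (simp_all add: sgn_div_norm)
    also have "\<dots> = integral {0..1} (\<lambda>y. (cmod (T (sgn c) y))\<^sup>2 * (norm c)\<^sup>2)"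
      unfolding Q_def scale by (simp add: power_mult_distrib mult.commute)
    finally show ?thesis by (simp add: Q_def)
  qed
  have Q0: "Q 0 = 0" using hom[of 0] by simp
  have "?S \<noteq> {}" by (auto simp: sphere_eq_empty)
  have sgnS: "sgn c \<in> ?S" if "c \<noteq> 0" for c :: 'v using that by (simp add: norm_sgn)
  have contS: "continuous_on ?S Q" using contQ continuous_on_subset by blast
  obtain c0 where c0: "c0 \<in> ?S" "\<And>c. c \<in> ?S \<Longrightarrow> Q c0 \<le> Q c"
    using continuous_attains_inf[OF compact_sphere \<open>?S \<noteq> {}\<close> contS] by blast
  obtain c1 where c1: "c1 \<in> ?S" "\<And>c. c \<in> ?S \<Longrightarrow> Q c \<le> Q c1"
    using continuous_attains_sup[OF compact_sphere \<open>?S \<noteq> {}\<close> contS] by blast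
  show ?thesis
  proof (rule that[of "Q c0" "Q c1"])
    have "c0 \<noteq> 0" using c0(1) by auto
    then show "0 < Q c0" by (rule pos)
    show "Q c0 \<le> Q c1" using c0(2) c1(1) by blast
    fix c
    show "Q c0 * (norm c)\<^sup>2 \<le> integral {0..1} (\<lambda>y. (cmod (T c y))\<^sup>2)"
      using c0(2)[OF sgnS[of c]] hom[of c] Q0
      by (cases "c = 0") (auto simp: Q_def[symmetric] intro: mult_right_mono)
    show "integral {0..1} (\<lambda>y. (cmod (T c y))\<^sup>2) \<le> Q c1 * (norm c)\<^sup>2"
      using c1(2)[OF sgnS[of c]] hom[of c] Q0
      by (cases "c = 0") (auto simp: Q_def[symmetric] intro: mult_right_mono)
  qed
qed

section \<open>Energy of a function given cell by cell\<close>

text \<open>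
  The half-open cells \<open>[n, n + 1)\<close> partition the line, so Tonelli's theorem for Lebesgue and
  counting measure turns the energy of \<open>f\<close> into the sum of the energies of the cells, each moved
  to the unit interval by a translation.
\<close>

lemma cellwise_energy:
  fixes G :: "int \<Rightarrow> real \<Rightarrow> complex"
  assumes cont: "\<And>n. continuous_on UNIV (G n)"
    and summable: "(\<lambda>n. integral {0..1} (\<lambda>y. (cmod (G n y))\<^sup>2)) summable_on UNIV"
  defines "f \<equiv> \<lambda>x. G \<lfloor>x\<rfloor> (x - of_int \<lfloor>x\<rfloor>)"
  shows "f \<in> L2_fun"
    and "(L2_fun_norm f)\<^sup>2 = (\<Sum>\<^sub>\<infinity>n. integral {0..1} (\<lambda>y. (cmod (G n y))\<^sup>2))"
proof -
  define q where "q n = integral {0..1} (\<lambda>y. (cmod (G n y))\<^sup>2)" for n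
  have [measurable]: "G n \<in> borel_measurable borel" for n
    using cont by (rule borel_measurable_continuous_onI)
  have [measurable]: "f \<in> borel_measurable borel"
    unfolding f_def
  proof (rule measurable_compose_countable[where f="\<lambda>n x. G n (x - of_int n)"])
    show "(\<lambda>x. G n (x - of_int n)) \<in> borel_measurable borel" for n by measurable
    show "(floor :: real \<Rightarrow> int) \<in> borel \<rightarrow>\<^sub>M count_space UNIV"
      by (rule measurable_real_floor)
  qed
  have csq: "continuous_on {0..1} (\<lambda>y. (cmod (G n y))\<^sup>2)" for n
    using cont[of n] by (intro continuous_intros) (auto intro: continuous_on_subset)
  have q_nonneg: "0 \<le> q n" for n
    unfolding q_def by (rule integral_nonneg[OF integrable_continuous_real[OF csq]]) auto
  have cell: "(\<integral>\<^sup>+x. ennreal ((cmod (f x))\<^sup>2) * indicator {n..<n+1} x \<partial>lborel) = ennreal (q n')"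
    if n: "n = of_int n'" for n n'
  proof -
    have "(\<integral>\<^sup>+x. ennreal ((cmod (f x))\<^sup>2) * indicator {n..<n+1} x \<partial>lborel)
        = (\<integral>\<^sup>+x. ennreal ((cmod (G n' (x - n)))\<^sup>2) * indicator {n..<n+1} x \<partial>lborel)"
    proof (rule nn_integral_cong)
      fix x :: real
      have "\<lfloor>x\<rfloor> = n'" if "x \<in> {n..<n+1}" using that n by (simp add: floor_eq_iff)
      then show "ennreal ((cmod (f x))\<^sup>2) * indicator {n..<n+1} x
          = ennreal ((cmod (G n' (x - n)))\<^sup>2) * indicator {n..<n+1} x"
        using n by (cases "x \<in> {n..<n+1}") (simp_all add: f_def)
    qed
    also have "\<dots> = (\<integral>\<^sup>+y. ennreal ((cmod (G n' y))\<^sup>2) * indicator {0..<1} y \<partial>lborel)"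
      by (subst nn_integral_real_affine[where c=1 and t=n])
        (auto intro!: nn_integral_cong split: split_indicator)
    \<comment> \<open>Passing to the closed interval adds only the null set \<open>{1}\<close>.\<close>
    also have "\<dots> = (\<integral>\<^sup>+y. ennreal (indicator {0..1} y *\<^sub>R (cmod (G n' y))\<^sup>2) \<partial>lborel)"
      by (rule nn_integral_cong_AE, rule AE_mp[OF AE_lborel_singleton[of 1]])
        (auto split: split_indicator)
    also have "\<dots> = ennreal (LINT y|lborel. indicator {0..1} y *\<^sub>R (cmod (G n' y))\<^sup>2)"
      using borel_integrable_atLeastAtMost'[OF csq[of n']]
      by (intro nn_integral_eq_integral) (auto simp: set_integrable_def)
    also have "\<dots> = ennreal (q n')"
      using set_borel_integral_eq_integral(2)[OF borel_integrable_atLeastAtMost'[OF csq[of n']]]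
      by (simp add: q_def set_lebesgue_integral_def)
    finally show ?thesis .
  qed
  have abs_q: "Infinite_Set_Sum.abs_summable_on q UNIV"
    using summable q_nonneg by (simp add: abs_summable_equivalent[symmetric] q_def[symmetric])
  have "(\<integral>\<^sup>+x. ennreal ((cmod (f x))\<^sup>2) \<partial>lborel)
      = (\<integral>\<^sup>+x. \<integral>\<^sup>+n. ennreal ((cmod (f x))\<^sup>2) * indicator {of_int n..<of_int n+1} x
          \<partial>count_space (UNIV::int set) \<partial>lborel)"
  proof (rule nn_integral_cong)
    fix x :: real
    have ind: "(\<lambda>n::int. indicator {of_int n..<of_int n+1} x :: ennreal) = indicator {\<lfloor>x\<rfloor>}"
      by (auto simp: fun_eq_iff indicator_def floor_eq_iff) (use floor_unique in force)+
    then show "ennreal ((cmod (f x))\<^sup>2) = (\<integral>\<^sup>+n. ennreal ((cmod (f x))\<^sup>2)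
        * indicator {of_int n..<of_int n+1} x \<partial>count_space (UNIV::int set))"
      by (subst nn_integral_cmult) auto
  qed
  also have "\<dots> = (\<integral>\<^sup>+n. \<integral>\<^sup>+x. ennreal ((cmod (f x))\<^sup>2) * indicator {of_int n..<of_int n+1} x
      \<partial>lborel \<partial>count_space (UNIV::int set))"
    by (rule nn_integral_count_space_nn_integral) auto
  also have "\<dots> = (\<integral>\<^sup>+n. ennreal (q n) \<partial>count_space UNIV)"
    by (simp add: cell)
  also have "\<dots> = ennreal (infsum q UNIV)"
    using nn_integral_conv_infsetsum[OF abs_q] q_nonneg infsetsum_infsum[OF abs_q] by simp
  finally have nn: "(\<integral>\<^sup>+x. ennreal ((cmod (f x))\<^sup>2) \<partial>lborel) = ennreal (infsum q UNIV)" .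
  have "integrable lborel (\<lambda>x. (cmod (f x))\<^sup>2)"
    using nn by (intro integrableI_nonneg) auto
  then show "f \<in> L2_fun" by (simp add: L2_fun_def)
  have "(LINT x|lborel. (cmod (f x))\<^sup>2) = infsum q UNIV"
    using nn q_nonneg by (subst integral_eq_nn_integral) (auto intro!: infsum_nonneg enn2real_ennreal)
  then show "(L2_fun_norm f)\<^sup>2 = (\<Sum>\<^sub>\<infinity>n. integral {0..1} (\<lambda>y. (cmod (G n y))\<^sup>2))"
    unfolding L2_fun_norm_def using q_nonneg by (simp add: infsum_nonneg q_def[abs_def])
qed

section \<open>The Hermite conditions\<close>

text \<open>
  The formulas of \<open>g1\<close> and \<open>g2\<close> without the cut-off to \<open>[0, 1]\<close>. They are smooth on the
  whole line, so that slopes at the ends of the interval are ordinary two-sided derivatives.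
\<close>

definition value_profile :: "real \<Rightarrow> real \<Rightarrow> real" where
  "value_profile \<omega> x =
    (if \<omega> = 0 then (2 * x + 1) * (x - 1)\<^sup>2
     else 1 - sin (\<omega>/2) / s_coeff \<omega>
          + \<omega> * cos (\<omega>/2) / s_coeff \<omega> * x
          + sin (\<omega>/2 - \<omega> * x) / s_coeff \<omega>)"

definition slope_profile :: "real \<Rightarrow> real \<Rightarrow> real" where
  "slope_profile \<omega> x =
    (if \<omega> = 0 then x * (x - 1)\<^sup>2
     else (sin \<omega> - \<omega> * cos \<omega>) / (\<omega> * u_coeff \<omega>)
          + sin (\<omega>/2) / s_coeff \<omega> * x
          - (\<omega>\<^sup>2 * cos (\<omega>/2) * cos (\<omega> * (1 - x))
             + sin (\<omega>/2) * (sin (\<omega> * x) * u_coeff \<omega> - cos (\<omega> * x) * v_coeff \<omega>))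
            / (2 * \<omega> * sin (\<omega>/2) * s_coeff \<omega> * t_coeff \<omega>))"

text \<open>
  With \<open>h = \<omega> / 2\<close> this is \<open>h * cos h < sin h\<close>: the difference vanishes at \<open>0\<close> and has
  derivative \<open>x * sin x\<close>, which is positive up to \<open>h \<le> pi / 2\<close>.
\<close>

lemma s_coeff_pos:
  assumes "0 < \<omega>" "\<omega> \<le> pi"
  shows "0 < s_coeff \<omega>"
proof -
  define h where "h = \<omega> / 2"
  have h: "0 < h" "h \<le> pi / 2" using assms by (auto simp: h_def)
  have "(\<lambda>x. sin x - x * cos x) 0 < (\<lambda>x. sin x - x * cos x) h"
  proof (rule DERIV_pos_imp_increasing_open[OF h(1)])
    fix x :: real assume x: "0 < x" "x < h"
    have "((\<lambda>x. sin x - x * cos x) has_real_derivative x * sin x) (at x)"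
      by (auto intro!: derivative_eq_intros)
    moreover have "0 < x * sin x" using x h by (simp add: sin_gt_zero)
    ultimately show "\<exists>y. ((\<lambda>x. sin x - x * cos x) has_real_derivative y) (at x) \<and> 0 < y" by blast
  qed (auto intro!: continuous_intros)
  then show ?thesis by (simp add: s_coeff_def h_def)
qed

lemma t_coeff_pos:
  assumes "0 < \<omega>" "\<omega> \<le> pi"
  shows "0 < t_coeff \<omega>"
  unfolding t_coeff_def using assms
  by (intro add_pos_nonneg) (auto intro!: mult_nonneg_nonneg cos_ge_zero sin_gt_zero)

lemma u_coeff_eq: "u_coeff \<omega> = - 2 * sin (\<omega>/2) * s_coeff \<omega>"
proof -
  have "sin \<omega> = 2 * sin (\<omega>/2) * cos (\<omega>/2)" "cos \<omega> = 1 - 2 * (sin (\<omega>/2))\<^sup>2"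
    using sin_double[of "\<omega>/2"] cos_double_sin[of "\<omega>/2"] by simp_all
  then show ?thesis by (simp add: u_coeff_def s_coeff_def algebra_simps power2_eq_square)
qed

lemma v_coeff_eq: "v_coeff \<omega> = 2 * sin (\<omega>/2) * (2 * cos (\<omega>/2) + \<omega> * sin (\<omega>/2))"
proof -
  have "sin \<omega> = 2 * sin (\<omega>/2) * cos (\<omega>/2)" "cos \<omega> = 1 - 2 * (sin (\<omega>/2))\<^sup>2"
    using sin_double[of "\<omega>/2"] cos_double_sin[of "\<omega>/2"] by simp_all
  then have "v_coeff \<omega> = 2 * (2 * sin (\<omega>/2) * cos (\<omega>/2)) + \<omega> * (1 - (1 - 2 * (sin (\<omega>/2))\<^sup>2))"
    unfolding v_coeff_def by (simp only:)
  then show ?thesis by (simp add: algebra_simps power2_eq_square)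
qed

lemma value_profile_hermite:
  assumes "0 \<le> \<omega>" "\<omega> \<le> pi"
  shows "value_profile \<omega> 0 = 1" "value_profile \<omega> 1 = 0"
    "(value_profile \<omega> has_real_derivative 0) (at 0)"
    "(value_profile \<omega> has_real_derivative 0) (at 1)"
proof -
  have s: "s_coeff \<omega> \<noteq> 0" if "\<omega> \<noteq> 0" using s_coeff_pos[of \<omega>] assms that by auto
  show "value_profile \<omega> 0 = 1" by (simp add: value_profile_def)
  have "sin (- (\<omega> / 2)) = - sin (\<omega>/2)" by (rule sin_minus)
  then have sm: "sin (\<omega>/2 - \<omega>) = - sin (\<omega>/2)" by simp
  show "value_profile \<omega> 1 = 0"
  proof (cases "\<omega> = 0")
    case False
    have "value_profile \<omega> 1 = 1 - (2 * sin (\<omega>/2) - \<omega> * cos (\<omega>/2)) / s_coeff \<omega>"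
      using False sm by (simp add: value_profile_def diff_divide_distrib)
    then show ?thesis using s[OF False] by (simp add: s_coeff_def)
  qed (simp add: value_profile_def)
  have cm: "cos (\<omega>/2 - \<omega>) = cos (\<omega>/2)" using cos_minus[of "\<omega>/2"] by simp
  show "(value_profile \<omega> has_real_derivative 0) (at 0)"
    unfolding value_profile_def[abs_def]
    using s by (cases "\<omega> = 0") (auto intro!: derivative_eq_intros simp: field_simps)
  show "(value_profile \<omega> has_real_derivative 0) (at 1)"
    unfolding value_profile_def[abs_def]
    using s cm by (cases "\<omega> = 0") (auto intro!: derivative_eq_intros simp: field_simps)
qed

text \<open>
  With \<open>S = sin (\<omega>/2)\<close>, \<open>C = cos (\<omega>/2)\<close>, \<open>s = s_coeff \<omega>\<close> and \<open>t = t_coeff \<omega>\<close>,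
  the values and slopes at \<open>0\<close> and \<open>1\<close> are quotients of polynomials with the common denominator \<open>2 * \<omega> * S * s * t\<close>,
  which is nonzero for \<open>0 < \<omega> \<le> pi\<close>. The conditions
  reduce to polynomial identities modulo \<open>S\<^sup>2 + C\<^sup>2 = 1\<close>.
\<close>

lemma slope_profile_hermite:
  assumes "0 \<le> \<omega>" "\<omega> \<le> pi"
  shows "slope_profile \<omega> 0 = 0" "slope_profile \<omega> 1 = 0"
    "(slope_profile \<omega> has_real_derivative 1) (at 0)"
    "(slope_profile \<omega> has_real_derivative 0) (at 1)"
proof -
  have *: "slope_profile \<omega> 0 = 0 \<and> slope_profile \<omega> 1 = 0 \<and>
    (slope_profile \<omega> has_real_derivative 1) (at 0) \<and>
    (slope_profile \<omega> has_real_derivative 0) (at 1)"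
  proof (cases "\<omega> = 0")
    case True
    then show ?thesis unfolding slope_profile_def[abs_def]
      by (auto intro!: derivative_eq_intros)
  next
    case False
    define S C s t where "S = sin (\<omega>/2)" and "C = cos (\<omega>/2)"
      and "s = s_coeff \<omega>" and "t = t_coeff \<omega>"
    have w: "\<omega> > 0" using False assms by simp
    have nz: "S \<noteq> 0" "s \<noteq> 0" "t \<noteq> 0" "\<omega> \<noteq> 0"
      using s_coeff_pos[OF w assms(2)] t_coeff_pos[OF w assms(2)] w assms sin_gt_zero[of "\<omega>/2"]
      by (auto simp: S_def s_def t_def)
    have SC: "C\<^sup>2 = 1 - S\<^sup>2" by (simp add: S_def C_def cos_squared_eq)
    have st: "s = 2 * S - \<omega> * C" "t = 2 * S + \<omega> * C"
      by (simp_all add: s_def t_def s_coeff_def t_coeff_def S_def C_def)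
    have dbl: "sin \<omega> = 2 * S * C" "cos \<omega> = 1 - 2 * S\<^sup>2"
      using sin_double[of "\<omega>/2"] cos_double_sin[of "\<omega>/2"] by (simp_all add: S_def C_def)
    have form: "slope_profile \<omega> = (\<lambda>x. - (sin \<omega> - \<omega> * cos \<omega>) / (2 * \<omega> * S * s) + S / s * x
      - (\<omega>\<^sup>2 * C * cos (\<omega> * (1 - x))
         - 2 * S\<^sup>2 * (s * sin (\<omega> * x) + (2 * C + \<omega> * S) * cos (\<omega> * x))) / (2 * \<omega> * S * s * t))"
    proof
      fix x
      have const: "(sin \<omega> - \<omega> * cos \<omega>) / (\<omega> * u_coeff \<omega>) = - (sin \<omega> - \<omega> * cos \<omega>) / (2 * \<omega> * S * s)"
        using nz by (simp add: u_coeff_eq S_def[symmetric] s_def[symmetric] divide_simps)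
      have trig: "S * (sin (\<omega> * x) * u_coeff \<omega> - cos (\<omega> * x) * v_coeff \<omega>)
          = - 2 * S\<^sup>2 * (s * sin (\<omega> * x) + (2 * C + \<omega> * S) * cos (\<omega> * x))"
        unfolding u_coeff_eq v_coeff_eq S_def[symmetric] C_def[symmetric] s_def[symmetric]
        by (simp add: algebra_simps power2_eq_square)
      show "slope_profile \<omega> x = - (sin \<omega> - \<omega> * cos \<omega>) / (2 * \<omega> * S * s) + S / s * x
        - (\<omega>\<^sup>2 * C * cos (\<omega> * (1 - x))
         - 2 * S\<^sup>2 * (s * sin (\<omega> * x) + (2 * C + \<omega> * S) * cos (\<omega> * x))) / (2 * \<omega> * S * s * t)"
        using False unfolding slope_profile_def S_def[symmetric] C_def[symmetric] s_def[symmetric]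
          t_def[symmetric] const trig by simp
    qed
    have D: "(slope_profile \<omega> has_real_derivative (S / s
      - (\<omega>\<^sup>2 * C * (\<omega> * sin (\<omega> * (1 - x)))
         - 2 * S\<^sup>2 * (s * (\<omega> * cos (\<omega> * x)) - (2 * C + \<omega> * S) * (\<omega> * sin (\<omega> * x)))) / (2 * \<omega> * S * s * t))) (at x)"
      for x
    proof -
      have A: "((\<lambda>x. cos (\<omega> * (1 - x))) has_real_derivative \<omega> * sin (\<omega> * (1 - x))) (at x)"
        and B: "((\<lambda>x. sin (\<omega> * x)) has_real_derivative \<omega> * cos (\<omega> * x)) (at x)"
        and E: "((\<lambda>x. cos (\<omega> * x)) has_real_derivative - (\<omega> * sin (\<omega> * x))) (at x)"
        by (auto intro!: derivative_eq_intros)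
      note num = DERIV_diff[OF DERIV_cmult[OF A, of "\<omega>\<^sup>2 * C"]
          DERIV_cmult[OF DERIV_add[OF DERIV_cmult[OF B, of s] DERIV_cmult[OF E, of "2 * C + \<omega> * S"]],
            of "2 * S\<^sup>2"]]
      show ?thesis unfolding form
        by (rule DERIV_cong[OF DERIV_diff[OF DERIV_add[OF DERIV_const DERIV_cmult_Id]
          DERIV_cdivide[OF num]]]) simp
    qed
    have common: "- x / (2 * \<omega> * S * s) + S / s * z - y / (2 * \<omega> * S * s * t)
        = (2 * \<omega> * S\<^sup>2 * z * t - x * t - y) / (2 * \<omega> * S * s * t)" for x y z
      using nz by (simp add: diff_divide_distrib power2_eq_square)
    have common': "S / s - y / (2 * \<omega> * S * s * t) = (2 * \<omega> * S\<^sup>2 * t - y) / (2 * \<omega> * S * s * t)" for y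
      using common[of 0 1 y] by simp
    \<comment> \<open>Each vanishing numerator below is an explicit multiple of this expression.\<close>
    have R: "1 - S\<^sup>2 - C\<^sup>2 = 0" using SC by simp
    have "slope_profile \<omega> 0 = (2 * \<omega> * S * (1 - S\<^sup>2 - C\<^sup>2)) / (2 * \<omega> * S * s * t)"
      unfolding form common
      by (rule arg_cong2[where f="(/)"]) (simp_all add: dbl st algebra_simps power2_eq_square)
    then have "slope_profile \<omega> 0 = 0" unfolding R by simp
    moreover
    have "slope_profile \<omega> 1 = (2 * \<omega> * S * (1 + 2 * S\<^sup>2) * (1 - S\<^sup>2 - C\<^sup>2)) / (2 * \<omega> * S * s * t)"
      unfolding form common
      by (rule arg_cong2[where f="(/)"]) (simp_all add: dbl st algebra_simps power2_eq_square)
    then have "slope_profile \<omega> 1 = 0" unfolding R by simp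
    moreover have "S / s - (\<omega>\<^sup>2 * C * (\<omega> * sin (\<omega> * (1 - 0)))
         - 2 * S\<^sup>2 * (s * (\<omega> * cos (\<omega> * 0)) - (2 * C + \<omega> * S) * (\<omega> * sin (\<omega> * 0)))) / (2 * \<omega> * S * s * t) = 1"
    proof -
      have "2 * \<omega> * S\<^sup>2 * t - (\<omega>\<^sup>2 * C * (\<omega> * sin (\<omega> * (1 - 0)))
         - 2 * S\<^sup>2 * (s * (\<omega> * cos (\<omega> * 0)) - (2 * C + \<omega> * S) * (\<omega> * sin (\<omega> * 0)))) = 2 * \<omega> * S * s * t"
        unfolding st by (simp add: dbl algebra_simps power2_eq_square)
      then show ?thesis unfolding common' using nz by simp
    qed
    moreover have "S / s - (\<omega>\<^sup>2 * C * (\<omega> * sin (\<omega> * (1 - 1)))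
         - 2 * S\<^sup>2 * (s * (\<omega> * cos (\<omega> * 1)) - (2 * C + \<omega> * S) * (\<omega> * sin (\<omega> * 1)))) / (2 * \<omega> * S * s * t) = 0"
    proof -
      have "2 * \<omega> * S\<^sup>2 * t - (\<omega>\<^sup>2 * C * (\<omega> * sin (\<omega> * (1 - 1)))
         - 2 * S\<^sup>2 * (s * (\<omega> * cos (\<omega> * 1)) - (2 * C + \<omega> * S) * (\<omega> * sin (\<omega> * 1))))
         = 8 * \<omega> * S ^ 3 * (1 - S\<^sup>2 - C\<^sup>2)"
        unfolding st by (simp add: dbl algebra_simps power2_eq_square power3_eq_cube)
      then show ?thesis unfolding common' R by simp
    qed
    ultimately show ?thesis using D[of 0] D[of 1] by simp
  qed
  show "slope_profile \<omega> 0 = 0" "slope_profile \<omega> 1 = 0"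
    "(slope_profile \<omega> has_real_derivative 1) (at 0)"
    "(slope_profile \<omega> has_real_derivative 0) (at 1)" using * by auto
qed

lemma continuous_on_profiles:
  assumes "continuous_on A f"
  shows "continuous_on A (\<lambda>x. value_profile \<omega> (f x))" "continuous_on A (\<lambda>x. slope_profile \<omega> (f x))"
proof -
  have "continuous_on UNIV (value_profile \<omega>)"
    unfolding value_profile_def[abs_def] divide_inverse
    by (cases "\<omega> = 0") (auto intro!: continuous_intros)
  then show "continuous_on A (\<lambda>x. value_profile \<omega> (f x))"
    by (rule continuous_on_compose2[OF _ assms]) auto
  have "continuous_on UNIV (slope_profile \<omega>)"
    unfolding slope_profile_def[abs_def] divide_inverse
    by (cases "\<omega> = 0") (auto intro!: continuous_intros)
  then show "continuous_on A (\<lambda>x. slope_profile \<omega> (f x))"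
    by (rule continuous_on_compose2[OF _ assms]) auto
qed

section \<open>The Hermite interpolant on one cell\<close>

text \<open>
  The parameter \<open>c\<close> holds the coefficient vectors of the two generators centred at the left and
  at the right end of the cell. The generator at the right end enters through its reflected half;
  the minus sign is that of the odd extension of \<open>g2\<close>.
\<close>

definition hermite_cell :: "real \<Rightarrow> (complex ^ 2) \<times> (complex ^ 2) \<Rightarrow> real \<Rightarrow> complex" where
  "hermite_cell \<omega> c y =
     value_profile \<omega> y *\<^sub>R (fst c $ 1) + slope_profile \<omega> y *\<^sub>R (fst c $ 2)
     + value_profile \<omega> (1 - y) *\<^sub>R (snd c $ 1) - slope_profile \<omega> (1 - y) *\<^sub>R (snd c $ 2)"

lemma hermite_cell_derivative:
  assumes "(value_profile \<omega> has_real_derivative v0) (at y)"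
    and "(slope_profile \<omega> has_real_derivative s0) (at y)"
    and "(value_profile \<omega> has_real_derivative v1) (at (1 - y))"
    and "(slope_profile \<omega> has_real_derivative s1) (at (1 - y))"
  shows "(hermite_cell \<omega> c has_vector_derivative
    v0 *\<^sub>R (fst c $ 1) + s0 *\<^sub>R (fst c $ 2) - v1 *\<^sub>R (snd c $ 1) + s1 *\<^sub>R (snd c $ 2)) (at y)"
proof -
  have flip: "((\<lambda>y. 1 - y) has_real_derivative - 1) (at y)"
    by (auto intro!: derivative_eq_intros)
  have v1: "((\<lambda>y. value_profile \<omega> (1 - y)) has_real_derivative - v1) (at y)"
    using DERIV_chain'[where f="\<lambda>y. 1 - y", OF flip assms(3)] by simp
  have s1: "((\<lambda>y. slope_profile \<omega> (1 - y)) has_real_derivative - s1) (at y)"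
    using DERIV_chain'[where f="\<lambda>y. 1 - y", OF flip assms(4)] by simp
  show ?thesis
    unfolding hermite_cell_def[abs_def]
    using has_vector_derivative_diff[OF has_vector_derivative_add[OF has_vector_derivative_add[OF
      has_vector_derivative_scaleR[OF assms(1) has_vector_derivative_const[of "fst c $ 1"]]
      has_vector_derivative_scaleR[OF assms(2) has_vector_derivative_const[of "fst c $ 2"]]]
      has_vector_derivative_scaleR[OF v1 has_vector_derivative_const[of "snd c $ 1"]]]
      has_vector_derivative_scaleR[OF s1 has_vector_derivative_const[of "snd c $ 2"]]]
    by simp
qed

text \<open>
  The four coefficients are the values and the slopes of the interpolant at \<open>0\<close> and \<open>1\<close>, and all of
  these vanish with the interpolant. The derivative is taken within the unit interval, because
  nothing is known about the interpolant outside.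
\<close>

lemma hermite_cell_eq_0_imp:
  assumes w: "0 \<le> \<omega>" "\<omega> \<le> pi"
    and zero: "\<And>y. y \<in> {0..1} \<Longrightarrow> hermite_cell \<omega> c y = 0"
  shows "c = 0"
proof -
  note V = value_profile_hermite[OF w] and S = slope_profile_hermite[OF w]
  have D: "d = 0" if "(hermite_cell \<omega> c has_vector_derivative d) (at y)" "y \<in> {0..1}" for d y
  proof (rule vector_derivative_unique_within_closed_interval[of 0 1 y "hermite_cell \<omega> c"])
    show "(hermite_cell \<omega> c has_vector_derivative d) (at y within cbox 0 1)"
      using that(1) by (rule has_vector_derivative_at_within)
    show "(hermite_cell \<omega> c has_vector_derivative 0) (at y within cbox 0 1)"
      by (rule has_vector_derivative_transform[of y "cbox 0 1" _ "\<lambda>_. 0"])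
        (use that zero in auto)
  qed (use that in auto)
  have "fst c $ 1 = 0" using zero[of 0] V S by (simp add: hermite_cell_def)
  moreover have "snd c $ 1 = 0" using zero[of 1] V S by (simp add: hermite_cell_def)
  moreover have "fst c $ 2 = 0"
    using D[OF hermite_cell_derivative[of \<omega> 0 0 1 0 0 c]] V S by simp
  moreover have "snd c $ 2 = 0"
    using D[OF hermite_cell_derivative[of \<omega> 0 1 0 0 1 c]] V S by simp
  ultimately show ?thesis by (simp add: prod_eq_iff vec_eq_iff forall_2)
qed

lemma continuous_on_hermite_cell:
  assumes "continuous_on A f" "continuous_on A g"
  shows "continuous_on A (\<lambda>x. hermite_cell \<omega> (f x) (g x))"
  unfolding hermite_cell_def
  by (intro continuous_intros continuous_on_profiles assms)

lemma hermite_cell_scaleR: "hermite_cell \<omega> (r *\<^sub>R c) y = r *\<^sub>R hermite_cell \<omega> c y"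
  by (simp add: hermite_cell_def algebra_simps)

section \<open>Locality of the translates\<close>

text \<open>
  Only the generators centred at the two ends of the cell containing \<open>x\<close> contribute. At an integer
  \<open>x\<close> the closed support of the generator centred at \<open>x - 1\<close> still reaches \<open>x\<close>; that term drops out
  because both profiles vanish at \<open>1\<close>.
\<close>

lemma translate_term_local:
  assumes w: "0 \<le> \<omega>" "\<omega> \<le> pi"
  shows "translate_term \<omega> a n x =
    (if n = \<lfloor>x\<rfloor> then hermite_cell \<omega> (a n, 0) (x - of_int \<lfloor>x\<rfloor>)
     else if n = \<lfloor>x\<rfloor> + 1 then hermite_cell \<omega> (0, a n) (x - of_int \<lfloor>x\<rfloor>)
     else 0)"
proof -
  have g: "g1 \<omega> z = value_profile \<omega> z * indicator {0..1} z"
    "g2 \<omega> z = slope_profile \<omega> z * indicator {0..1} z" for z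
    by (simp_all add: g1_def g2_def value_profile_def slope_profile_def)
  have expand: "translate_term \<omega> a n x =
      phi1 \<omega> (x - of_int n) *\<^sub>R (a n $ 1) + phi2 \<omega> (x - of_int n) *\<^sub>R (a n $ 2)"
    by (simp add: translate_term_def hermite_gen_def UNIV_2 scaleR_conv_of_real mult.commute)
  define y where "y = x - of_int \<lfloor>x\<rfloor>"
  have y: "0 \<le> y" "y < 1" by (auto simp: y_def) linarith+
  consider "n = \<lfloor>x\<rfloor>" | "n = \<lfloor>x\<rfloor> + 1" | "n < \<lfloor>x\<rfloor>" | "n > \<lfloor>x\<rfloor> + 1" by linarith
  then show ?thesis
  proof cases
    case 1
    then have "x - of_int n = y" by (simp add: y_def)
    then show ?thesis using 1 y expand
      by (simp add: phi1_def phi2_def g hermite_cell_def y_def[symmetric])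
  next
    case 2
    then have "x - of_int n = y - 1" by (simp add: y_def)
    with expand have "translate_term \<omega> a n x =
        phi1 \<omega> (y - 1) *\<^sub>R (a n $ 1) + phi2 \<omega> (y - 1) *\<^sub>R (a n $ 2)"
      by (simp only:)
    then show ?thesis using 2 y
      by (simp add: phi1_def phi2_def g hermite_cell_def y_def[symmetric])
  next
    case 3
    then have "x - of_int n \<ge> 1" by linarith
    then have "phi1 \<omega> (x - of_int n) = 0" "phi2 \<omega> (x - of_int n) = 0"
      using value_profile_hermite(2)[OF w] slope_profile_hermite(2)[OF w]
      by (cases "x - of_int n = 1"; simp add: phi1_def phi2_def g)+
    then show ?thesis using 3 expand by simp
  next
    case 4
    then have "x - of_int n < -1" by linarith
    then show ?thesis using 4 expand by (simp add: phi1_def phi2_def g)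
  qed
qed

lemma translate_series_local:
  assumes w: "0 \<le> \<omega>" "\<omega> \<le> pi"
  shows "translate_series \<omega> a x
    = hermite_cell \<omega> (a \<lfloor>x\<rfloor>, a (\<lfloor>x\<rfloor> + 1)) (x - of_int \<lfloor>x\<rfloor>)"
proof -
  have "translate_series \<omega> a x = (\<Sum>\<^sub>\<infinity>n\<in>{\<lfloor>x\<rfloor>, \<lfloor>x\<rfloor> + 1}. translate_term \<omega> a n x)"
    unfolding translate_series_def
    by (rule infsum_cong_neutral) (auto simp: translate_term_local[OF w])
  then show ?thesis
    by (simp add: translate_term_local[OF w] hermite_cell_def)
qed

lemma sum_translate_term_eq_series:
  assumes "finite N"
  shows "(\<Sum>n\<in>N. translate_term \<omega> a n x)
    = translate_series \<omega> (\<lambda>n. if n \<in> N then a n else 0) x"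
proof -
  have "translate_series \<omega> (\<lambda>n. if n \<in> N then a n else 0) x = (\<Sum>\<^sub>\<infinity>n\<in>N. translate_term \<omega> a n x)"
    unfolding translate_series_def
    by (rule infsum_cong_neutral) (auto simp: translate_term_def)
  then show ?thesis using assms by simp
qed

lemma translate_series_diff:
  assumes w: "0 \<le> \<omega>" "\<omega> \<le> pi"
  shows "translate_series \<omega> a x - translate_series \<omega> b x = translate_series \<omega> (\<lambda>n. a n - b n) x"
  unfolding translate_series_local[OF w] hermite_cell_def by (simp add: algebra_simps)

section \<open>The Riesz bounds\<close>

text \<open>
  The cell bounds \<open>m\<close> and \<open>M\<close> apply to the pairs \<open>(a n, a (n + 1))\<close>, whose squared norms add up
  to \<open>2 * (l2_seq_norm a)\<^sup>2\<close>.
\<close>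

lemma translate_series_bounds:
  assumes w: "0 \<le> \<omega>" "\<omega> \<le> pi"
  obtains \<alpha> \<beta> :: real where "0 < \<alpha>" "\<alpha> \<le> \<beta>"
    "\<And>a. a \<in> l2_seq \<Longrightarrow> translate_series \<omega> a \<in> L2_fun"
    "\<And>a. a \<in> l2_seq \<Longrightarrow> \<alpha> * l2_seq_norm a \<le> L2_fun_norm (translate_series \<omega> a)"
    "\<And>a. a \<in> l2_seq \<Longrightarrow> L2_fun_norm (translate_series \<omega> a) \<le> \<beta> * l2_seq_norm a"
proof -
  define q where "q c = integral {0..1} (\<lambda>y. (cmod (hermite_cell \<omega> c y))\<^sup>2)" for c
  have "continuous_on (UNIV \<times> {0..1}) (\<lambda>(c, y). hermite_cell \<omega> c y)"
    unfolding case_prod_beta by (intro continuous_on_hermite_cell continuous_intros)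
  then obtain m M where mM: "0 < m" "m \<le> M"
    and lo: "\<And>c. m * (norm c)\<^sup>2 \<le> q c" and hi: "\<And>c. q c \<le> M * (norm c)\<^sup>2"
    unfolding q_def
    using unit_interval_energy_bounds[of "hermite_cell \<omega>"]
      hermite_cell_scaleR hermite_cell_eq_0_imp[OF w] by metis
  have key: "translate_series \<omega> a \<in> L2_fun"
    "2 * m * (l2_seq_norm a)\<^sup>2 \<le> (L2_fun_norm (translate_series \<omega> a))\<^sup>2"
    "(L2_fun_norm (translate_series \<omega> a))\<^sup>2 \<le> 2 * M * (l2_seq_norm a)\<^sup>2"
    if a: "a \<in> l2_seq" for a
  proof -
    define e where "e n = (norm (a n, a (n + 1)))\<^sup>2" for n
    have sm: "(\<lambda>n. (norm (a n))\<^sup>2) summable_on UNIV" using a by (simp add: l2_seq_def)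
    have bij: "bij_betw (\<lambda>n::int. n + 1) UNIV UNIV"
      by (rule bij_betw_byWitness[where f'="\<lambda>n. n - 1"]) auto
    have sm': "(\<lambda>n. (norm (a (n + 1)))\<^sup>2) summable_on UNIV"
      using sm summable_on_reindex_bij_betw[OF bij, of "\<lambda>n. (norm (a n))\<^sup>2"] by simp
    have shift: "(\<Sum>\<^sub>\<infinity>n. (norm (a (n + 1)))\<^sup>2) = (\<Sum>\<^sub>\<infinity>n. (norm (a n))\<^sup>2)"
      using infsum_reindex_bij_betw[OF bij, of "\<lambda>n. (norm (a n))\<^sup>2"] by simp
    have e: "e n = (norm (a n))\<^sup>2 + (norm (a (n + 1)))\<^sup>2" for n
      by (simp add: e_def norm_Pair)
    have e_sm: "e summable_on UNIV"
      unfolding e using sm sm' by (rule summable_on_add)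
    have norm2: "(l2_seq_norm a)\<^sup>2 = (\<Sum>\<^sub>\<infinity>n. (norm (a n))\<^sup>2)"
      unfolding l2_seq_norm_def by (simp add: infsum_nonneg)
    have e_sum: "(\<Sum>\<^sub>\<infinity>n. e n) = 2 * (l2_seq_norm a)\<^sup>2"
      unfolding e infsum_add[OF sm sm'] shift norm2 by simp
    have "q (a n, a (n + 1)) \<ge> 0" for n
      using lo[of "(a n, a (n + 1))"] mM by (smt (verit) mult_nonneg_nonneg zero_le_power2)
    moreover have "(\<lambda>n. M * e n) summable_on UNIV" using e_sm by (rule summable_on_cmult_right)
    ultimately have q_sm: "(\<lambda>n. q (a n, a (n + 1))) summable_on UNIV"
      by (rule summable_on_comparison_test[rotated 2]) (use hi in \<open>auto simp: e_def\<close>)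
    have cont: "continuous_on UNIV (hermite_cell \<omega> (a n, a (n + 1)))" for n
      by (intro continuous_on_hermite_cell[of UNIV "\<lambda>_. _" "\<lambda>x. x"] continuous_intros)
    have series: "translate_series \<omega> a
      = (\<lambda>x. hermite_cell \<omega> (a \<lfloor>x\<rfloor>, a (\<lfloor>x\<rfloor> + 1)) (x - of_int \<lfloor>x\<rfloor>))"
      by (simp add: translate_series_local[OF w] fun_eq_iff)
    note energy = cellwise_energy[of "\<lambda>n. hermite_cell \<omega> (a n, a (n + 1))",
        OF cont q_sm[unfolded q_def], folded series q_def]
    show "translate_series \<omega> a \<in> L2_fun" by (rule energy(1))
    have "(\<Sum>\<^sub>\<infinity>n. m * e n) \<le> (\<Sum>\<^sub>\<infinity>n. q (a n, a (n + 1)))"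
      by (rule infsum_mono[OF summable_on_cmult_right[OF e_sm] q_sm]) (use lo in \<open>simp add: e_def\<close>)
    then show "2 * m * (l2_seq_norm a)\<^sup>2 \<le> (L2_fun_norm (translate_series \<omega> a))\<^sup>2"
      by (simp add: infsum_cmult_right' energy(2) e_sum)
    have "(\<Sum>\<^sub>\<infinity>n. q (a n, a (n + 1))) \<le> (\<Sum>\<^sub>\<infinity>n. M * e n)"
      by (rule infsum_mono[OF q_sm summable_on_cmult_right[OF e_sm]]) (use hi in \<open>simp add: e_def\<close>)
    then show "(L2_fun_norm (translate_series \<omega> a))\<^sup>2 \<le> 2 * M * (l2_seq_norm a)\<^sup>2"
      by (simp add: infsum_cmult_right' energy(2) e_sum)
  qed
  have nn: "0 \<le> L2_fun_norm f" "0 \<le> l2_seq_norm a" for f a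
    by (auto simp: L2_fun_norm_def l2_seq_norm_def intro!: infsum_nonneg)
  show ?thesis
  proof (rule that[of "sqrt (2 * m)" "sqrt (2 * M)"])
    fix a assume a: "a \<in> l2_seq"
    show "translate_series \<omega> a \<in> L2_fun" by (rule key(1)[OF a])
    show "sqrt (2 * m) * l2_seq_norm a \<le> L2_fun_norm (translate_series \<omega> a)"
    proof (rule power2_le_imp_le)
      show "(sqrt (2 * m) * l2_seq_norm a)\<^sup>2 \<le> (L2_fun_norm (translate_series \<omega> a))\<^sup>2"
        using key(2)[OF a] mM(1) by (simp add: power_mult_distrib)
    qed (rule nn)
    show "L2_fun_norm (translate_series \<omega> a) \<le> sqrt (2 * M) * l2_seq_norm a"
    proof (rule power2_le_imp_le)
      have "0 \<le> 2 * M" using mM by simp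
      then show "(L2_fun_norm (translate_series \<omega> a))\<^sup>2 \<le> (sqrt (2 * M) * l2_seq_norm a)\<^sup>2"
        using key(3)[OF a] by (simp add: power_mult_distrib)
      show "0 \<le> sqrt (2 * M) * l2_seq_norm a" using \<open>0 \<le> 2 * M\<close> nn by simp
    qed
  qed (use mM in auto)
qed

lemma l2_seq_restrict:
  assumes "a \<in> l2_seq"
  shows "(\<lambda>n. if n \<in> A then a n else 0) \<in> l2_seq"
proof -
  have "(\<lambda>n. (norm (a n))\<^sup>2) summable_on A"
    using assms by (auto simp: l2_seq_def intro: summable_on_subset_banach)
  then have "(\<lambda>n. (norm (if n \<in> A then a n else 0))\<^sup>2) summable_on UNIV"
    by (subst summable_on_cong_neutral[where T=A and g="\<lambda>n. (norm (a n))\<^sup>2"]) auto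
  then show ?thesis by (simp add: l2_seq_def)
qed

lemma l2_seq_norm_tail_tendsto_0:
  assumes "a \<in> l2_seq"
  shows "((\<lambda>N. l2_seq_norm (\<lambda>n. if n \<in> - N then a n else 0)) \<longlongrightarrow> 0) (finite_subsets_at_top UNIV)"
proof -
  let ?e = "\<lambda>n. (norm (a n))\<^sup>2"
  have sm: "?e summable_on UNIV" using assms by (simp add: l2_seq_def)
  have tail: "l2_seq_norm (\<lambda>n. if n \<in> - N then a n else 0) = sqrt (infsum ?e UNIV - sum ?e N)"
    if "finite N" for N
  proof -
    have "(\<Sum>\<^sub>\<infinity>n. (norm (if n \<in> - N then a n else 0))\<^sup>2) = infsum ?e (UNIV - N)"
      by (rule infsum_cong_neutral) auto
    also have "\<dots> = infsum ?e UNIV - infsum ?e N"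
      by (rule infsum_Diff) (use sm that in auto)
    finally show ?thesis using that by (simp add: l2_seq_norm_def)
  qed
  have "(sum ?e \<longlongrightarrow> infsum ?e UNIV) (finite_subsets_at_top UNIV)"
    using has_sum_infsum[OF sm] by (simp add: has_sum_def)
  then have "((\<lambda>N. sqrt (infsum ?e UNIV - sum ?e N)) \<longlongrightarrow> sqrt (infsum ?e UNIV - infsum ?e UNIV))
      (finite_subsets_at_top UNIV)"
    by (intro tendsto_intros)
  then have "((\<lambda>N. sqrt (infsum ?e UNIV - sum ?e N)) \<longlongrightarrow> 0) (finite_subsets_at_top UNIV)"
    by simp
  then show ?thesis
    by (rule Lim_transform_eventually)
      (rule eventually_finite_subsets_at_top_weakI, rule tail[symmetric])
qed

text \<open>
  The bounds come from \<open>translate_series_bounds\<close>. Both further claims are applications of it to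
  truncated coefficients: a single term is the series of coefficients supported at one index, and
  the error of the partial sum over \<open>N\<close> is, up to sign, the series of the coefficients off \<open>N\<close>,
  bounded by \<open>\<beta>\<close> times a norm that tends to zero.
\<close>

theorem theorem1:
  fixes \<omega> :: real
  assumes "0 \<le> \<omega>" and "\<omega> \<le> pi"
  shows "\<exists>\<alpha> \<beta> :: real. 0 < \<alpha> \<and> \<alpha> \<le> \<beta> \<and>
    (\<forall>a \<in> l2_seq.
       has_L2_sum (translate_term \<omega> a) (translate_series \<omega> a) \<and>
       \<alpha> * l2_seq_norm a \<le> L2_fun_norm (translate_series \<omega> a) \<and>
       L2_fun_norm (translate_series \<omega> a) \<le> \<beta> * l2_seq_norm a)"
proof -
  note w = assms
  obtain \<alpha> \<beta> :: real where ab: "0 < \<alpha>" "\<alpha> \<le> \<beta>"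
    and L2: "\<And>a. a \<in> l2_seq \<Longrightarrow> translate_series \<omega> a \<in> L2_fun"
    and lo: "\<And>a. a \<in> l2_seq \<Longrightarrow> \<alpha> * l2_seq_norm a \<le> L2_fun_norm (translate_series \<omega> a)"
    and hi: "\<And>a. a \<in> l2_seq \<Longrightarrow> L2_fun_norm (translate_series \<omega> a) \<le> \<beta> * l2_seq_norm a"
    using translate_series_bounds[OF w] by metis
  have "has_L2_sum (translate_term \<omega> a) (translate_series \<omega> a)" if a: "a \<in> l2_seq" for a
    unfolding has_L2_sum_def
  proof (intro conjI allI)
    show "translate_series \<omega> a \<in> L2_fun" by (rule L2[OF a])
    show "translate_term \<omega> a n \<in> L2_fun" for n
    proof -
      have "translate_term \<omega> a n = translate_series \<omega> (\<lambda>k. if k \<in> {n} then a k else 0)"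
        using sum_translate_term_eq_series[of "{n}" \<omega> a] by (simp add: fun_eq_iff)
      then show ?thesis using L2[OF l2_seq_restrict[OF a, of "{n}"]] by simp
    qed
    let ?tail = "\<lambda>N n. if n \<in> - N then a n else 0"
    have err: "L2_fun_norm (\<lambda>x. (\<Sum>n\<in>N. translate_term \<omega> a n x) - translate_series \<omega> a x)
        = L2_fun_norm (translate_series \<omega> (?tail N))" if "finite N" for N
    proof -
      have "translate_series \<omega> a x - (\<Sum>n\<in>N. translate_term \<omega> a n x) = translate_series \<omega> (?tail N) x" for x
        unfolding sum_translate_term_eq_series[OF that] translate_series_diff[OF w]
        by (rule arg_cong[where f="\<lambda>b. translate_series \<omega> b x"]) auto
      then show ?thesis
        unfolding L2_fun_norm_def by (metis (no_types, lifting) norm_minus_commute)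
    qed
    show "((\<lambda>N. L2_fun_norm (\<lambda>x. (\<Sum>n\<in>N. translate_term \<omega> a n x) - translate_series \<omega> a x)) \<longlongrightarrow> 0)
        (finite_subsets_at_top UNIV)"
    proof (rule tendsto_sandwich[where f="\<lambda>_. 0"])
      show "((\<lambda>N. \<beta> * l2_seq_norm (?tail N)) \<longlongrightarrow> 0) (finite_subsets_at_top UNIV)"
        using tendsto_mult_left[OF l2_seq_norm_tail_tendsto_0[OF a], of \<beta>] by simp
      show "\<forall>\<^sub>F N in finite_subsets_at_top UNIV.
          L2_fun_norm (\<lambda>x. (\<Sum>n\<in>N. translate_term \<omega> a n x) - translate_series \<omega> a x)
          \<le> \<beta> * l2_seq_norm (?tail N)"
        by (rule eventually_finite_subsets_at_top_weakI)
          (subst err, assumption, rule hi[OF l2_seq_restrict[OF a]])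
    qed (auto simp: L2_fun_norm_def)
  qed
  then show ?thesis using ab lo hi by blast
qed

end
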